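(* Let $\Phi$ be a quantifier-free Presburger formula, i.e. a Boolean combination (using $\land,\lor,\neg$) of $m$ linear constraints $\phi_1,\dots,\phi_m$, where $\phi_i$ is $\sum_{j=1}^n a_{i,j}x_j\ge b_i$ with $a_{i,j},b_i\in\mathbb{Z}$, over integer variables $x_1,\dots,x_n$. Let $\Phi'$ be the formula obtained from $\Phi$ by introducing the zero variable $x_0$: each $x_j$ ($1\le j\le n$) is replaced by $x_j-x_0$, so that $\phi_i$ becomes $\phi_i'$: $\sum_{j=1}^n a_{i,j}x_j-\bigl(\sum_{j=1}^n a_{i,j}\bigr)x_0\ge b_i$, and the variables $x_0,x_1,\dots,x_n$ now range over the nonnegative integers. Suppose that exactly $m-k$ of the constraints $\phi_i'$ are difference constraints, with $k\le n+1$, and that each of the remaining $k$ non-difference constraints $\phi'_i$ has at most $w$ nonzero variable coefficients, where $w\ge 1$ is an integer. Let $a_{\max}$ be the maximum absolute value of a variable coefficient (including coefficients of $x_0$) in $\phi'_1,\dots,\phi'_m$, let $b_{\max}=\max_i|b_i|$, let $s=\min(n+1,m)$, and let $$\Delta = s\,(b_{\max}+1)\,(a_{\max}\,w)^k .$$ If $\Phi'$ is satisfiable (over nonnegative integers), then $\Phi'$ has a solution in nonnegative integers all of whose entries (the values of $x_0,x_1,\dots,x_n$) are at most $(n+2)\Delta$.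
   Context: A constraint $\phi'_i$ in the variables $x_0,\dots,x_n$ is a difference constraint if exactly one of its variable coefficients is $+1$, exactly one is $-1$, and all others are $0$ (this corresponds to an original constraint of one of the forms $x_i-x_j\ge b$, $x_i\ge b$, $-x_i\ge b$). All other constraints are non-difference constraints. The formula $\Phi$ is satisfiable over $\mathbb{Z}$ if and only if $\Phi'$ is satisfiable over the nonnegative integers. The convention $0^0=1$ is used. *)

theory Defs
  imports Complex_Main
begin

text \<open>
  A linear constraint \<open>Geq c b\<close> stands for \<open>(\<Sum>j\<in>V. c j * x j) \<ge> b\<close>, where the finite set \<open>V\<close> of
  variable indices is supplied when the constraint is interpreted: \<open>{1..n}\<close> for original
  constraints, \<open>{0..n}\<close> after the zero variable has been introduced. Values of \<open>c\<close> and \<open>x\<close>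
  outside \<open>V\<close> are irrelevant.
\<close>

datatype lin_constraint = Geq (coeff: "nat \<Rightarrow> int") (bound: int)

datatype (atoms: 'a) formula =
    Atom 'a
  | Neg "'a formula"
  | Conj "'a formula" "'a formula"
  | Disj "'a formula" "'a formula"
  for map: map_formula

type_synonym presburger = "lin_constraint formula"

definition sat_constraint :: "nat set \<Rightarrow> (nat \<Rightarrow> int) \<Rightarrow> lin_constraint \<Rightarrow> bool" where
  "sat_constraint V x \<phi> \<longleftrightarrow> (\<Sum>j\<in>V. coeff \<phi> j * x j) \<ge> bound \<phi>"

primrec sat :: "nat set \<Rightarrow> (nat \<Rightarrow> int) \<Rightarrow> presburger \<Rightarrow> bool" where
  "sat V x (Atom \<phi>) \<longleftrightarrow> sat_constraint V x \<phi>"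
| "sat V x (Neg F) \<longleftrightarrow> \<not> sat V x F"
| "sat V x (Conj F G) \<longleftrightarrow> sat V x F \<and> sat V x G"
| "sat V x (Disj F G) \<longleftrightarrow> sat V x F \<or> sat V x G"

definition zero_var_constraint :: "nat \<Rightarrow> lin_constraint \<Rightarrow> lin_constraint" where
  "zero_var_constraint n \<phi> =
     Geq (\<lambda>j. if j = 0 then - (\<Sum>l=1..n. coeff \<phi> l) else coeff \<phi> j) (bound \<phi>)"

definition zero_var :: "nat \<Rightarrow> presburger \<Rightarrow> presburger" where
  "zero_var n F = map_formula (zero_var_constraint n) F"

definition difference_constraint :: "nat \<Rightarrow> lin_constraint \<Rightarrow> bool" where
  "difference_constraint n \<phi> \<longleftrightarrow>
     (\<exists>!j. j \<in> {0..n} \<and> coeff \<phi> j = 1) \<and>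
     (\<exists>!j. j \<in> {0..n} \<and> coeff \<phi> j = -1) \<and>
     (\<forall>j\<in>{0..n}. coeff \<phi> j \<noteq> 1 \<and> coeff \<phi> j \<noteq> -1 \<longrightarrow> coeff \<phi> j = 0)"

text \<open>The transformation is the substitution of \<open>x j - x 0\<close> for \<open>x j\<close>.\<close>

lemma sat_constraint_zero_var:
  "sat_constraint {0..n} x (zero_var_constraint n \<phi>) \<longleftrightarrow>
   sat_constraint {1..n} (\<lambda>j. x j - x 0) \<phi>"
proof -
  have "(\<Sum>j=0..n. coeff (zero_var_constraint n \<phi>) j * x j) =
        (\<Sum>j=1..n. coeff \<phi> j * x j) - (\<Sum>j=1..n. coeff \<phi> j) * x 0"
    by (simp add: sum.atLeast_Suc_atMost zero_var_constraint_def)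
  also have "\<dots> = (\<Sum>j=1..n. coeff \<phi> j * (x j - x 0))"
    by (simp add: right_diff_distrib sum_subtractf sum_distrib_right)
  finally show ?thesis
    by (simp add: sat_constraint_def zero_var_constraint_def)
qed

lemma sat_zero_var: "sat {0..n} x (zero_var n F) \<longleftrightarrow> sat {1..n} (\<lambda>j. x j - x 0) F"
  by (induction F) (simp_all add: zero_var_def sat_constraint_zero_var)

end

theory Submission
  imports "Jordan_Normal_Form.Determinant" Defs
begin

text \<open>
  Fix a solution \<open>x\<close> and orient every constraint so that \<open>x\<close> satisfies it; a violated constraint
  \<open>c \<cdot> x \<ge> b\<close> becomes \<open>-c \<cdot> x \<ge> 1 - b\<close>, whence the summand \<open>1\<close> in \<open>b_max + 1\<close>. The resulting system
  together with \<open>x \<ge> 0\<close> is homogenised, with \<open>N = n + 1\<close> variables plus a last coordinate \<open>\<ge> 0\<close>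
  that multiplies the right-hand sides, so its solutions form a pointed cone. The point \<open>(x, 1)\<close>
  is a nonnegative combination of at most \<open>N + 1\<close> integer vectors on extreme rays. Subtracting
  integer multiples of those with last coordinate \<open>0\<close>, of which there are at most \<open>N\<close>, leaves an
  integer solution whose entries are at most \<open>N + 1\<close> times the largest entry of these vectors.
  Their entries are minors of the system. Laplace expansion along the column of right-hand sides
  and along the \<open>k\<close> non-difference rows reduces such a minor to determinants of network
  matrices, which lie in \<open>{-1, 0, 1}\<close>; this gives the bound \<open>\<Delta>\<close>.
\<close>

subsection \<open>Determinants of near-network matrices\<close>

text \<open>Gaussian elimination: the vectors \<open>M u\<close> are the rows, and a row with a
  nonzero entry in column \<open>d\<close> serves as pivot.\<close>

lemma underdetermined_system:
  fixes M :: "'a \<Rightarrow> nat \<Rightarrow> real"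
  assumes "finite U" "d < card U"
  shows "\<exists>c. (\<exists>u\<in>U. c u \<noteq> 0) \<and> (\<forall>j<d. (\<Sum>u\<in>U. c u * M u j) = 0)"
  using assms
proof (induction d arbitrary: U M)
  case 0
  then have "U \<noteq> {}" by auto
  then show ?case by (intro exI[of _ "\<lambda>_. 1"]) auto
next
  case (Suc d)
  show ?case
  proof (cases "\<forall>u\<in>U. M u d = 0")
    case True
    obtain c where "\<exists>u\<in>U. c u \<noteq> 0" "\<forall>j<d. (\<Sum>u\<in>U. c u * M u j) = 0"
      using Suc.IH[of U M] Suc.prems by auto
    with True show ?thesis
      by (intro exI[of _ c]) (auto simp: less_Suc_eq)
  next
    case False
    then obtain p where p: "p \<in> U" "M p d \<noteq> 0" by auto
    \<comment> \<open>Subtracting multiples of row \<open>p\<close> clears column \<open>d\<close>.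
      A dependency of the reduced rows lifts to \<open>M\<close> once \<open>cp\<close> collects
      these multiples as the coefficient of row \<open>p\<close>.\<close>
    define M' where "M' = (\<lambda>u j. M u j - M u d / M p d * M p j)"
    obtain c where c: "\<exists>u\<in>U - {p}. c u \<noteq> 0" "\<forall>j<d. (\<Sum>u\<in>U - {p}. c u * M' u j) = 0"
      using Suc.IH[of "U - {p}" M'] Suc.prems p by (metis card_Diff_singleton finite_Diff less_diff_conv Suc_eq_plus1)
    define cp where "cp = - (\<Sum>u\<in>U - {p}. c u * (M u d / M p d))"
    have split: "(\<Sum>u\<in>U. (c(p := cp)) u * M u j) = (\<Sum>u\<in>U - {p}. c u * M' u j)" for j
    proof -
      have "(\<Sum>u\<in>U. (c(p := cp)) u * M u j) = cp * M p j + (\<Sum>u\<in>U - {p}. c u * M u j)"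
        using p(1) Suc.prems(1) by (subst sum.remove[of U p]) (auto intro!: sum.cong)
      also have "\<dots> = (\<Sum>u\<in>U - {p}. c u * M' u j)"
        by (simp add: cp_def M'_def sum_distrib_right sum_subtractf right_diff_distrib mult.assoc)
      finally show ?thesis .
    qed
    have "M' u d = 0" for u using p(2) by (simp add: M'_def)
    then have "\<forall>j<Suc d. (\<Sum>u\<in>U. (c(p := cp)) u * M u j) = 0"
      using c(2) by (auto simp only: split less_Suc_eq) auto
    moreover have "\<exists>u\<in>U. (c(p := cp)) u \<noteq> 0" using c(1) by auto
    ultimately show ?thesis by blast
  qed
qed

section \<open>Laplace expansion of submatrix determinants\<close>

text \<open>Rows and columns are chosen by index functions, so deleting row \<open>i\<close> is
  composition with \<open>insert_index i\<close>, the increasing map that skips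
  \<open>i\<close>.\<close>

definition submatrix_det :: "('i \<Rightarrow> nat \<Rightarrow> int) \<Rightarrow> nat \<Rightarrow> (nat \<Rightarrow> 'i) \<Rightarrow> (nat \<Rightarrow> nat) \<Rightarrow> int" where
  "submatrix_det g r \<rho> \<kappa> = det (mat r r (\<lambda>(i, j). g (\<rho> i) (\<kappa> j)))"

lemma mat_delete_mat:
  assumes "i < Suc r" "j < Suc r"
  shows "mat_delete (mat (Suc r) (Suc r) (\<lambda>(i, j). g (\<rho> i) (\<kappa> j))) i j =
    mat r r (\<lambda>(p, q). g (\<rho> (insert_index i p)) (\<kappa> (insert_index j q)))"
  by (rule eq_matI) (auto simp: mat_delete_def insert_index_def)

lemma abs_cofactor:
  assumes "i < Suc r" "j < Suc r"
  shows "\<bar>cofactor (mat (Suc r) (Suc r) (\<lambda>(i, j). g (\<rho> i) (\<kappa> j))) i j\<bar> =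
    \<bar>submatrix_det g r (\<rho> \<circ> insert_index i) (\<kappa> \<circ> insert_index j)\<bar>"
  using assms
  by (simp add: cofactor_def submatrix_det_def mat_delete_mat abs_mult power_abs)

text \<open>Laplace expansion with the signs discarded; the minors are again values of
  \<open>submatrix_det\<close>, which permits induction on the size.\<close>

lemma abs_submatrix_det_le_row:
  assumes "i < Suc r"
  shows "\<bar>submatrix_det g (Suc r) \<rho> \<kappa>\<bar> \<le>
    (\<Sum>j<Suc r. \<bar>g (\<rho> i) (\<kappa> j)\<bar> *
      \<bar>submatrix_det g r (\<rho> \<circ> insert_index i) (\<kappa> \<circ> insert_index j)\<bar>)"
proof -
  let ?A = "mat (Suc r) (Suc r) (\<lambda>(i, j). g (\<rho> i) (\<kappa> j))"
  have "\<bar>submatrix_det g (Suc r) \<rho> \<kappa>\<bar> = \<bar>\<Sum>j<Suc r. ?A $$ (i, j) * cofactor ?A i j\<bar>"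
    unfolding submatrix_det_def using assms by (subst laplace_expansion_row[of _ "Suc r" i]) auto
  also have "\<dots> \<le> (\<Sum>j<Suc r. \<bar>?A $$ (i, j) * cofactor ?A i j\<bar>)" by (rule sum_abs)
  also have "\<dots> = (\<Sum>j<Suc r. \<bar>g (\<rho> i) (\<kappa> j)\<bar> *
      \<bar>submatrix_det g r (\<rho> \<circ> insert_index i) (\<kappa> \<circ> insert_index j)\<bar>)"
    using assms by (intro sum.cong refl) (simp add: abs_mult abs_cofactor del: lessThan_Suc sum.lessThan_Suc)
  finally show ?thesis .
qed

lemma abs_submatrix_det_le_column:
  assumes "j < Suc r"
  shows "\<bar>submatrix_det g (Suc r) \<rho> \<kappa>\<bar> \<le>
    (\<Sum>i<Suc r. \<bar>g (\<rho> i) (\<kappa> j)\<bar> *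
      \<bar>submatrix_det g r (\<rho> \<circ> insert_index i) (\<kappa> \<circ> insert_index j)\<bar>)"
proof -
  let ?A = "mat (Suc r) (Suc r) (\<lambda>(i, j). g (\<rho> i) (\<kappa> j))"
  have "\<bar>submatrix_det g (Suc r) \<rho> \<kappa>\<bar> = \<bar>\<Sum>i<Suc r. ?A $$ (i, j) * cofactor ?A i j\<bar>"
    unfolding submatrix_det_def using assms by (subst laplace_expansion_column[of _ "Suc r" j]) auto
  also have "\<dots> \<le> (\<Sum>i<Suc r. \<bar>?A $$ (i, j) * cofactor ?A i j\<bar>)" by (rule sum_abs)
  also have "\<dots> = (\<Sum>i<Suc r. \<bar>g (\<rho> i) (\<kappa> j)\<bar> *
      \<bar>submatrix_det g r (\<rho> \<circ> insert_index i) (\<kappa> \<circ> insert_index j)\<bar>)"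
    using assms by (intro sum.cong refl) (simp add: abs_mult abs_cofactor del: lessThan_Suc sum.lessThan_Suc)
  finally show ?thesis .
qed

text \<open>By injectivity \<open>\<rho> i\<close> does not recur among the remaining rows, so an
  induction may remove it from \<open>I\<close>.\<close>

lemma inj_on_comp_insert_index:
  assumes "inj_on \<rho> {..<Suc r}" "\<rho> ` {..<Suc r} \<subseteq> I" "i < Suc r"
  shows "inj_on (\<rho> \<circ> insert_index i) {..<r}" "(\<rho> \<circ> insert_index i) ` {..<r} \<subseteq> I - {\<rho> i}"
proof -
  have sub: "insert_index i ` {..<r} \<subseteq> {..<Suc r} - {i}" by (auto simp: insert_index_def)
  then show "inj_on (\<rho> \<circ> insert_index i) {..<r}"
    by (intro comp_inj_on insert_index_inj_on inj_on_subset[OF assms(1)]) auto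
  show "(\<rho> \<circ> insert_index i) ` {..<r} \<subseteq> I - {\<rho> i}"
  proof
    fix x assume "x \<in> (\<rho> \<circ> insert_index i) ` {..<r}"
    then obtain p where p: "p \<in> {..<Suc r} - {i}" "x = \<rho> p" using sub by auto
    then show "x \<in> I - {\<rho> i}" using assms inj_onD[OF assms(1), of p i] by auto
  qed
qed

section \<open>Network rows and bounds for their determinants\<close>

text \<open>At most one entry \<open>1\<close> and at most one \<open>-1\<close>. Unlike the
  difference rows alone, this class contains the unit vectors and is closed under deleting
  columns.\<close>

definition network_row :: "nat set \<Rightarrow> (nat \<Rightarrow> int) \<Rightarrow> bool" where
  "network_row J r \<longleftrightarrow> (\<forall>j\<in>J. r j \<in> {-1, 0, 1}) \<and>
     (\<forall>i\<in>J. \<forall>j\<in>J. r i = r j \<and> r i \<noteq> 0 \<longrightarrow> i = j)"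

text \<open>Two nonzero entries must be \<open>1\<close> and \<open>-1\<close>, and a third would
  repeat one of them.\<close>

lemma network_row_sum_eq_0:
  assumes "network_row J r" "finite J" "i \<in> J" "j \<in> J" "i \<noteq> j" "r i \<noteq> 0" "r j \<noteq> 0"
  shows "(\<Sum>l\<in>J. r l) = 0"
proof -
  have vals: "r l = -1 \<or> r l = 0 \<or> r l = 1" if "l \<in> J" for l
    using assms(1) that unfolding network_row_def by auto
  have inj: "r l \<noteq> r l'" if "l \<in> J" "l' \<in> J" "l \<noteq> l'" "r l \<noteq> 0" for l l'
    using assms(1) that unfolding network_row_def by blast
  have "r l = 0" if "l \<in> J - {i, j}" for l
    using vals[of l] vals[of i] vals[of j] inj[of l i] inj[of l j] inj[of i j] assms(3-) that by auto
  then have "(\<Sum>l\<in>J. r l) = (\<Sum>l\<in>{i, j}. r l)"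
    using assms by (intro sum.mono_neutral_right) auto
  also have "\<dots> = 0"
    using vals[of i] vals[of j] inj[of i j] assms(3-) by auto
  finally show ?thesis .
qed

lemma network_row_comp:
  assumes "network_row J r" "inj_on \<kappa> K" "\<kappa> ` K \<subseteq> J"
  shows "network_row K (r \<circ> \<kappa>)"
  unfolding network_row_def
proof (intro conjI ballI impI)
  fix i j assume ij: "i \<in> K" "j \<in> K" "(r \<circ> \<kappa>) i = (r \<circ> \<kappa>) j \<and> (r \<circ> \<kappa>) i \<noteq> 0"
  with assms have "\<kappa> i = \<kappa> j" unfolding network_row_def by (simp add: image_subset_iff)
  with ij assms(2) show "i = j" by (simp add: inj_on_eq_iff)
qed (use assms in \<open>auto simp: network_row_def image_subset_iff\<close>)

text \<open>Rows with both a \<open>1\<close> and a \<open>-1\<close> sum to zero; if every row is of this kind the matrix kills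
  the all-ones vector, and any other row has at most one nonzero entry to expand along.\<close>

lemma abs_network_det_le_1:
  assumes "\<And>i. i \<in> I \<Longrightarrow> network_row J (g i)"
    and "inj_on \<rho> {..<r}" "\<rho> ` {..<r} \<subseteq> I" "inj_on \<kappa> {..<r}" "\<kappa> ` {..<r} \<subseteq> J"
  shows "\<bar>submatrix_det g r \<rho> \<kappa>\<bar> \<le> 1"
  using assms(2-)
proof (induction r arbitrary: \<rho> \<kappa>)
  case 0
  then show ?case by (simp add: submatrix_det_def)
next
  case (Suc r)
  have nr: "network_row {..<Suc r} (g (\<rho> i) \<circ> \<kappa>)" if "i < Suc r" for i
    using Suc.prems that by (intro network_row_comp[OF assms(1)]) auto
  show ?case
  proof (cases "\<exists>i<Suc r. \<exists>q<Suc r. \<forall>j<Suc r. j \<noteq> q \<longrightarrow> g (\<rho> i) (\<kappa> j) = 0")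
    case True
    then obtain i q where iq: "i < Suc r" "q < Suc r"
      "\<And>j. j < Suc r \<Longrightarrow> j \<noteq> q \<Longrightarrow> g (\<rho> i) (\<kappa> j) = 0" by auto
    have "\<bar>submatrix_det g (Suc r) \<rho> \<kappa>\<bar> \<le>
      (\<Sum>j<Suc r. \<bar>g (\<rho> i) (\<kappa> j)\<bar> *
      \<bar>submatrix_det g r (\<rho> \<circ> insert_index i) (\<kappa> \<circ> insert_index j)\<bar>)"
      by (rule abs_submatrix_det_le_row[OF iq(1)])
    also have "\<dots> = \<bar>g (\<rho> i) (\<kappa> q)\<bar> *
      \<bar>submatrix_det g r (\<rho> \<circ> insert_index i) (\<kappa> \<circ> insert_index q)\<bar>"
      using iq by (subst sum.remove[of _ q]) (auto intro!: sum.neutral)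
    also have "\<dots> \<le> 1 * 1"
    proof (rule mult_mono)
      show "\<bar>g (\<rho> i) (\<kappa> q)\<bar> \<le> 1"
        using nr[OF iq(1)] iq(2) unfolding network_row_def by (auto dest!: bspec[of _ _ q])
      show "\<bar>submatrix_det g r (\<rho> \<circ> insert_index i) (\<kappa> \<circ> insert_index q)\<bar> \<le> 1"
        using inj_on_comp_insert_index[OF Suc.prems(1,2) iq(1)]
          inj_on_comp_insert_index[OF Suc.prems(3,4) iq(2)]
        by (intro Suc.IH) blast+
    qed auto
    finally show ?thesis by simp
  next
    case False
    have sum0: "(\<Sum>j<Suc r. g (\<rho> i) (\<kappa> j)) = 0" if i: "i < Suc r" for i
    proof -
      obtain q where q: "q < Suc r" "g (\<rho> i) (\<kappa> q) \<noteq> 0" using False i by blast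
      obtain q' where q': "q' < Suc r" "q' \<noteq> q" "g (\<rho> i) (\<kappa> q') \<noteq> 0" using False i q by blast
      show ?thesis
        using network_row_sum_eq_0[OF nr[OF i], of q q'] q q' by (simp del: sum.lessThan_Suc)
    qed
    let ?A = "mat (Suc r) (Suc r) (\<lambda>(i, j). g (\<rho> i) (\<kappa> j))"
    let ?v = "vec (Suc r) (\<lambda>_. 1 :: int)"
    have "?A *\<^sub>v ?v = 0\<^sub>v (Suc r)"
      using sum0 by (intro eq_vecI) (auto simp: scalar_prod_def lessThan_atLeast0 simp del: sum.op_ivl_Suc)
    moreover have "?v \<noteq> 0\<^sub>v (Suc r)"
      by (metis index_vec index_zero_vec(1) zero_less_Suc zero_neq_one)
    ultimately have "det ?A = 0"
      by (subst det_0_iff_vec_prod_zero[of _ "Suc r"]) (auto intro!: exI[of _ ?v])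
    then show ?thesis by (simp add: submatrix_det_def)
  qed
qed

text \<open>Rows of \<open>S\<close> are expanded one at a time, each at the cost of at most
  \<open>w\<close> entries of size at most \<open>A\<close>; a network matrix remains. As
  \<open>A * int w\<close> is at least \<open>1\<close>, the exponent \<open>card S\<close> also
  covers rows of \<open>S\<close> that were not selected.\<close>

lemma abs_submatrix_det_le_power:
  assumes "\<And>i. i \<in> I - S \<Longrightarrow> network_row J (g i)"
    and "\<And>i j. i \<in> S \<Longrightarrow> j \<in> J \<Longrightarrow> \<bar>g i j\<bar> \<le> A"
    and "\<And>i. i \<in> S \<Longrightarrow> card {j \<in> J. g i j \<noteq> 0} \<le> w"
    and "finite S" "finite J" "1 \<le> A * int w" "0 \<le> A"
    and "inj_on \<rho> {..<r}" "\<rho> ` {..<r} \<subseteq> I" "inj_on \<kappa> {..<r}" "\<kappa> ` {..<r} \<subseteq> J"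
  shows "\<bar>submatrix_det g r \<rho> \<kappa>\<bar> \<le> (A * int w) ^ card S"
  using assms
proof (induction r arbitrary: \<rho> \<kappa> S I)
  case 0
  then show ?case by (simp add: submatrix_det_def one_le_power)
next
  case (Suc r)
  show ?case
  proof (cases "\<exists>i<Suc r. \<rho> i \<in> S")
    case False
    then have "\<rho> ` {..<Suc r} \<subseteq> I - S" using Suc.prems(9) by auto
    then have "\<bar>submatrix_det g (Suc r) \<rho> \<kappa>\<bar> \<le> 1"
      using Suc.prems by (intro abs_network_det_le_1[of "I - S" J]) auto
    also have "1 \<le> (A * int w) ^ card S" using Suc.prems(6) by (rule one_le_power)
    finally show ?thesis .
  next
    case True
    then obtain i where i: "i < Suc r" "\<rho> i \<in> S" by blast
    let ?B = "(A * int w) ^ card (S - {\<rho> i})"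
    \<comment> \<open>The support of the row among the selected columns; \<open>\<kappa>\<close>
      embeds it into the support within \<open>J\<close>, so its size is at most
      \<open>w\<close>.\<close>
    let ?K = "{j \<in> {..<Suc r}. g (\<rho> i) (\<kappa> j) \<noteq> 0}"
    have minor: "\<bar>submatrix_det g r (\<rho> \<circ> insert_index i) (\<kappa> \<circ> insert_index j)\<bar> \<le> ?B"
      if "j < Suc r" for j
      using inj_on_comp_insert_index[OF Suc.prems(8,9) i(1)]
        inj_on_comp_insert_index[OF Suc.prems(10,11) that] Suc.prems
      by (intro Suc.IH[of "I - {\<rho> i}"]) (auto simp del: o_apply)
    have "card (\<kappa> ` ?K) \<le> card {j \<in> J. g (\<rho> i) j \<noteq> 0}"
      using Suc.prems(5,11) by (intro card_mono) auto
    moreover have "card (\<kappa> ` ?K) = card ?K"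
      by (rule card_image) (rule inj_on_subset[OF Suc.prems(10)], auto)
    ultimately have cardK: "card ?K \<le> w" using Suc.prems(3)[OF i(2)] by linarith
    have B0: "0 \<le> ?B" using Suc.prems(7) by simp
    have "\<bar>submatrix_det g (Suc r) \<rho> \<kappa>\<bar> \<le>
      (\<Sum>j<Suc r. \<bar>g (\<rho> i) (\<kappa> j)\<bar> *
      \<bar>submatrix_det g r (\<rho> \<circ> insert_index i) (\<kappa> \<circ> insert_index j)\<bar>)"
      by (rule abs_submatrix_det_le_row[OF i(1)])
    also have "\<dots> = (\<Sum>j\<in>?K. \<bar>g (\<rho> i) (\<kappa> j)\<bar> *
      \<bar>submatrix_det g r (\<rho> \<circ> insert_index i) (\<kappa> \<circ> insert_index j)\<bar>)"
      by (rule sum.mono_neutral_right) auto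
    also have "\<dots> \<le> (\<Sum>j\<in>?K. A * ?B)"
      using minor Suc.prems(2)[OF i(2)] Suc.prems(7,11)
      by (intro sum_mono mult_mono) (auto simp del: o_apply)
    also have "\<dots> = int (card ?K) * (A * ?B)" by simp
    also have "\<dots> \<le> int w * (A * ?B)"
      using cardK B0 Suc.prems(7) by (intro mult_right_mono) auto
    also have "\<dots> = (A * int w) ^ card S"
      by (subst card_Suc_Diff1[OF Suc.prems(4) i(2), symmetric]) (simp add: mult_ac)
    finally show ?thesis .
  qed
qed

subsection \<open>Ray decomposition in pointed integer cones\<close>

text \<open>Rows are integral for the sake of determinants; points are real because conic
  decompositions have real coefficients.\<close>

definition dot :: "nat \<Rightarrow> (nat \<Rightarrow> int) \<Rightarrow> (nat \<Rightarrow> real) \<Rightarrow> real" where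
  "dot d r z = (\<Sum>j<d. of_int (r j) * z j)"

lemma dot_diff_scale: "dot d r (\<lambda>j. y j - t * z j) = dot d r y - t * dot d r z"
  by (simp add: dot_def sum_subtractf sum_distrib_left right_diff_distrib mult.left_commute)

lemma dot_scale: "dot d r (\<lambda>j. t * z j) = t * dot d r z"
  by (simp add: dot_def sum_distrib_left mult.left_commute)

lemma dot_sum: "dot d r (\<lambda>j. \<Sum>v\<in>F. c v * z v j) = (\<Sum>v\<in>F. c v * dot d r (z v))"
  unfolding dot_def sum_distrib_left
  by (subst sum.swap) (simp add: mult.left_commute)

lemma dot_cong: "(\<And>j. j < d \<Longrightarrow> y j = z j) \<Longrightarrow> dot d r y = dot d r z"
  by (simp add: dot_def)

text \<open>The last of the \<open>Suc N\<close> coordinates is the homogenising one. Pointedness,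
  the absence of lines in the cone, is stated as a trivial common kernel of the rows.\<close>

locale pointed_cone =
  fixes I :: "'i set" and g :: "'i \<Rightarrow> nat \<Rightarrow> int" and N :: nat
  assumes finite_I: "finite I"
    and pointed: "\<And>y. (\<And>i. i \<in> I \<Longrightarrow> dot (Suc N) (g i) y = 0) \<Longrightarrow> \<forall>j<Suc N. y j = 0"
begin

abbreviation "slack i z \<equiv> dot (Suc N) (g i) z"

definition cone :: "(nat \<Rightarrow> real) set" where
  "cone = {z. \<forall>i\<in>I. 0 \<le> slack i z}"

definition tight :: "(nat \<Rightarrow> real) \<Rightarrow> 'i set" where
  "tight z = {i \<in> I. slack i z = 0}"

definition null_space :: "'i set \<Rightarrow> (nat \<Rightarrow> real) set" where
  "null_space U = {y. \<forall>i\<in>U. slack i y = 0}"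

definition nonzero :: "(nat \<Rightarrow> real) \<Rightarrow> bool" where
  "nonzero z \<longleftrightarrow> (\<exists>j<Suc N. z j \<noteq> 0)"

text \<open>Cramer's rule for \<open>N\<close> homogeneous equations in \<open>Suc N\<close>
  unknowns: entry \<open>j\<close> is the minor skipping column \<open>j\<close>. The absolute
  values absorb the cofactor signs and the choice of orientation.\<close>

definition ray :: "(nat \<Rightarrow> int) \<Rightarrow> bool" where
  "ray v \<longleftrightarrow> (\<lambda>j. of_int (v j)) \<in> cone \<and> nonzero (\<lambda>j. of_int (v j)) \<and>
     (\<exists>\<rho>. inj_on \<rho> {..<N} \<and> \<rho> ` {..<N} \<subseteq> I \<and>
       (\<forall>j<Suc N. \<bar>v j\<bar> = \<bar>submatrix_det g N \<rho> (insert_index j)\<bar>))"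

lemma nonzero_pos_slack:
  assumes "z \<in> cone" "nonzero z"
  obtains i where "i \<in> I" "0 < slack i z"
  using assms pointed[of z] unfolding cone_def nonzero_def by force

text \<open>Both the extreme-ray argument and the decomposition move from \<open>y\<close> along \<open>-z\<close> until the first
  constraint outside \<open>tight z\<close> becomes tight.\<close>

lemma ratio_step:
  assumes z: "z \<in> cone" "nonzero z"
    and y: "\<And>i. i \<in> I \<Longrightarrow> slack i z = 0 \<Longrightarrow> 0 \<le> slack i y"
  obtains t i where "(\<lambda>j. y j - t * z j) \<in> cone" "i \<in> I" "0 < slack i z"
    "slack i (\<lambda>j. y j - t * z j) = 0" "t = slack i y / slack i z"
proof -
  define R where "R = {i \<in> I. 0 < slack i z}"
  have R: "finite R" "R \<noteq> {}"
    using finite_I nonzero_pos_slack[OF z] unfolding R_def by auto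
  define q where "q i = slack i y / slack i z" for i
  \<comment> \<open>Minimum ratio test: subtracting a larger multiple of \<open>z\<close> would
    violate constraint \<open>i\<close>. The ratio may be negative, as \<open>y\<close> need not lie
    in the cone.\<close>
  obtain i where i: "i \<in> R" "\<And>l. l \<in> R \<Longrightarrow> q i \<le> q l"
    using arg_min_if_finite(1)[OF R, of q] arg_min_least[OF R, of _ q] by blast
  show ?thesis
  proof (rule that[of "q i" i])
    show "(\<lambda>j. y j - q i * z j) \<in> cone"
      unfolding cone_def
    proof (clarsimp simp: dot_diff_scale)
      fix l assume l: "l \<in> I"
      show "q i * slack l z \<le> slack l y"
      proof (cases "l \<in> R")
        case True
        then show ?thesis using i(2)[OF True] unfolding R_def
          by (simp add: q_def[of l] pos_le_divide_eq)
      next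
        case False
        then have "slack l z = 0" using z(1) l unfolding R_def cone_def by force
        then show ?thesis using y[OF l] by simp
      qed
    qed
    show "slack i (\<lambda>j. y j - q i * z j) = 0"
      using i(1) unfolding dot_diff_scale by (simp add: q_def R_def)
  qed (use i(1) in \<open>auto simp: R_def q_def\<close>)
qed

text \<open>A subset of least cardinality with trivial null space works: fewer than
  \<open>Suc N\<close> rows are underdetermined, and more would yield too many independent
  vectors.\<close>

lemma square_subsystem:
  assumes T: "T \<subseteq> I" and null: "\<And>y. y \<in> null_space T \<Longrightarrow> \<not> nonzero y"
  obtains U where "U \<subseteq> T" "card U = Suc N" "\<And>y. y \<in> null_space U \<Longrightarrow> \<not> nonzero y"
proof -
  define P where "P U \<longleftrightarrow> U \<subseteq> T \<and> (\<forall>y\<in>null_space U. \<not> nonzero y)" for U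
  obtain U where U: "P U" "\<And>V. P V \<Longrightarrow> card U \<le> card V"
    using ex_has_least_nat[of P T card] null unfolding P_def by blast
  have fin: "finite U" using U(1) T finite_I unfolding P_def by (meson finite_subset)
  have "\<not> card U < Suc N"
  proof
    assume less: "card U < Suc N"
    obtain \<rho> where \<rho>: "bij_betw \<rho> {..<card U} U"
      using ex_bij_betw_nat_finite[OF fin] by (auto simp: lessThan_atLeast0)
    obtain c where c: "\<exists>j\<in>{..<Suc N}. c j \<noteq> 0"
      "\<forall>p<card U. (\<Sum>j<Suc N. c j * real_of_int (g (\<rho> p) j)) = 0"
      using underdetermined_system[of "{..<Suc N}" "card U" "\<lambda>j p. real_of_int (g (\<rho> p) j)"] less
      by (auto simp del: sum.lessThan_Suc)
    have "c \<in> null_space U"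
      unfolding null_space_def
    proof (clarify)
      fix i assume "i \<in> U"
      then obtain p where "p < card U" "i = \<rho> p" using \<rho> unfolding bij_betw_def by auto
      then show "slack i c = 0" using c(2) by (simp add: dot_def mult.commute del: sum.lessThan_Suc)
    qed
    moreover have "nonzero c" using c(1) unfolding nonzero_def by auto
    ultimately show False using U(1) unfolding P_def by blast
  qed
  moreover have "\<not> Suc N < card U"
  proof
    assume less: "Suc N < card U"
    \<comment> \<open>By minimality some vector is annihilated by all rows except \<open>u\<close>.
      These vectors are too many to be independent, but applying row \<open>u\<close> to a
      dependency isolates the coefficient of \<open>u\<close>.\<close>
    have "\<exists>y. y \<in> null_space (U - {u}) \<and> slack u y \<noteq> 0" if u: "u \<in> U" for u
    proof -
      have "\<not> P (U - {u})" using U(2)[of "U - {u}"] u fin card_Diff1_less[OF fin u] by auto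
      then obtain y where y: "y \<in> null_space (U - {u})" "nonzero y"
        using U(1) unfolding P_def by auto
      moreover have "slack u y \<noteq> 0"
      proof
        assume "slack u y = 0"
        with y(1) have "y \<in> null_space U" unfolding null_space_def by auto
        with y(2) U(1) show False unfolding P_def by blast
      qed
      ultimately show ?thesis by blast
    qed
    then obtain y where y: "\<And>u. u \<in> U \<Longrightarrow> y u \<in> null_space (U - {u})" "\<And>u. u \<in> U \<Longrightarrow> slack u (y u) \<noteq> 0"
      by metis
    obtain c where c: "\<exists>u\<in>U. c u \<noteq> 0" "\<forall>j<Suc N. (\<Sum>u\<in>U. c u * y u j) = 0"
      using underdetermined_system[OF fin less, of y] by blast
    obtain u where u: "u \<in> U" "c u \<noteq> 0" using c(1) by blast
    have "0 = slack u (\<lambda>j. \<Sum>u\<in>U. c u * y u j)"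
      using c(2) by (simp add: dot_def del: sum.lessThan_Suc)
    also have "\<dots> = (\<Sum>u'\<in>U. c u' * slack u (y u'))" by (rule dot_sum)
    also have "\<dots> = (\<Sum>u'\<in>{u}. c u' * slack u (y u'))"
      using u(1) fin y(1) by (intro sum.mono_neutral_right) (auto simp: null_space_def)
    finally show False using u y(2) by simp
  qed
  ultimately have "card U = Suc N" by linarith
  then show ?thesis using that[of U] U(1) unfolding P_def by blast
qed

text \<open>A point of the cone with a maximal set of tight constraints spans an extreme ray. Completing
  suitable tight rows by one further row to a nonsingular matrix, the cofactors of that
  row form an integer vector on the same ray.\<close>

lemma ex_ray:
  assumes z: "z \<in> cone" "nonzero z"
  obtains v where "ray v" "tight z \<subseteq> tight (\<lambda>j. of_int (v j))"
proof -
  define P where "P y \<longleftrightarrow> y \<in> cone \<and> nonzero y \<and> tight z \<subseteq> tight y" for y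
  have "card (tight y) < Suc (card I)" for y
    using finite_I by (auto intro!: card_mono simp: tight_def less_Suc_eq_le)
  moreover have "P z" using z by (simp add: P_def)
  ultimately obtain e where e: "P e" "\<And>y. P y \<Longrightarrow> card (tight y) \<le> card (tight e)"
    using ex_has_greatest_nat[of P z "\<lambda>y. card (tight y)" "Suc (card I)"] by blast
  have e_cone: "e \<in> cone" and e_nz: "nonzero e" using e(1) unfolding P_def by auto
  \<comment> \<open>The constraints tight at \<open>e\<close> determine it up to a scalar: otherwise
    a move along \<open>e\<close> would reach a nonzero cone point with more tight
    constraints.\<close>
  have line: "\<exists>t. \<forall>j<Suc N. y j = t * e j" if y: "y \<in> null_space (tight e)" for y
  proof -
    have "0 \<le> slack i y" if "i \<in> I" "slack i e = 0" for i
      using y that by (simp add: null_space_def tight_def)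
    from ratio_step[OF e_cone e_nz this] obtain t i where t:
      "(\<lambda>j. y j - t * e j) \<in> cone" "i \<in> I" "0 < slack i e" "slack i (\<lambda>j. y j - t * e j) = 0"
      by blast
    let ?y = "\<lambda>j. y j - t * e j"
    have "tight e \<subseteq> tight ?y"
      using y unfolding tight_def null_space_def by (auto simp: dot_diff_scale)
    moreover have "i \<in> tight ?y" "i \<notin> tight e" using t unfolding tight_def by auto
    ultimately have "tight e \<subset> tight ?y" by blast
    then have "card (tight e) < card (tight ?y)"
      using finite_I by (intro psubset_card_mono) (auto simp: tight_def)
    then have "\<not> P ?y" using e(2) by force
    then have "\<not> nonzero ?y"
      using t(1) e(1) \<open>tight e \<subseteq> tight ?y\<close> unfolding P_def by blast
    then show ?thesis unfolding nonzero_def by (intro exI[of _ t]) auto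
  qed
  obtain i0 where i0: "i0 \<in> I" "0 < slack i0 e" using nonzero_pos_slack[OF e_cone e_nz] .
  \<comment> \<open>On the line through \<open>e\<close>, a constraint with positive slack at
    \<open>e\<close> vanishes only at the origin.\<close>
  have null0: "\<not> nonzero y" if y: "y \<in> null_space (insert i0 (tight e))" for y
  proof -
    obtain t where t: "\<forall>j<Suc N. y j = t * e j" using line[of y] y unfolding null_space_def by auto
    then have "slack i0 y = slack i0 (\<lambda>j. t * e j)" by (intro dot_cong) auto
    with y i0(2) have "t = 0" by (simp add: null_space_def dot_scale)
    with t show ?thesis unfolding nonzero_def by auto
  qed
  obtain U where U: "U \<subseteq> insert i0 (tight e)" "card U = Suc N"
    "\<And>y. y \<in> null_space U \<Longrightarrow> \<not> nonzero y"
    using square_subsystem[of "insert i0 (tight e)"] null0 i0(1) unfolding tight_def by auto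
  have finU: "finite U" using U(2) by (metis card.infinite nat.distinct(1))
  have "i0 \<in> U"
  proof (rule ccontr)
    assume "i0 \<notin> U"
    then have "e \<in> null_space U" using U(1) unfolding null_space_def tight_def by auto
    with U(3) e_nz show False by blast
  qed
  then have "card (U - {i0}) = N" using U(2) finU by simp
  then obtain \<rho> where \<rho>: "bij_betw \<rho> {..<N} (U - {i0})"
    using ex_bij_betw_nat_finite[of "U - {i0}"] finU by (auto simp: lessThan_atLeast0)
  \<comment> \<open>\<open>i0\<close> becomes row \<open>0\<close>, so the cofactors along that row
    involve tight rows only.\<close>
  define \<rho>' where "\<rho>' = case_nat i0 \<rho>"
  define B where "B = mat (Suc N) (Suc N) (\<lambda>(p, q). g (\<rho>' p) q)"
  have B: "B \<in> carrier_mat (Suc N) (Suc N)" by (simp add: B_def)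
  have U_eq: "U = \<rho>' ` {..<Suc N}"
    using \<rho> \<open>i0 \<in> U\<close> by (auto simp: lessThan_Suc_eq_insert_0 image_image \<rho>'_def bij_betw_def)
  have slack_B: "slack (\<rho>' p) (\<lambda>j. of_int (x j)) = of_int ((B *\<^sub>v vec (Suc N) x) $ p)"
    if "p < Suc N" for p x
    using that by (simp add: dot_def B_def scalar_prod_def lessThan_atLeast0 del: sum.op_ivl_Suc)
  have detB: "det B \<noteq> 0"
  proof
    assume "det B = 0"
    then obtain x where x: "x \<in> carrier_vec (Suc N)" "x \<noteq> 0\<^sub>v (Suc N)" "B *\<^sub>v x = 0\<^sub>v (Suc N)"
      using det_0_iff_vec_prod_zero[OF B] by auto
    have "vec (Suc N) (\<lambda>j. x $ j) = x" using x(1) by auto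
    then have "(\<lambda>j. of_int (x $ j)) \<in> null_space U"
      using slack_B[of _ "\<lambda>j. x $ j"] x(3) unfolding null_space_def U_eq by auto
    with U(3) have "\<forall>j<Suc N. x $ j = 0" unfolding nonzero_def by force
    with x(1) have "x = 0\<^sub>v (Suc N)" by (intro eq_vecI) auto
    with x(2) show False by simp
  qed
  \<comment> \<open>Multiplying \<open>B\<close> by its adjugate shows that \<open>v\<close> is
    annihilated by every row but row \<open>0\<close>, where the value is
    \<open>det B\<close>.\<close>
  define v where "v j = cofactor B 0 j" for j
  have Bv: "(B *\<^sub>v vec (Suc N) v) $ p = (if p = 0 then det B else 0)" if p: "p < Suc N" for p
  proof -
    have "(B *\<^sub>v vec (Suc N) v) $ p = (B * adj_mat B) $$ (p, 0)"
      using p B by (simp add: adj_mat_def v_def scalar_prod_def)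
    also have "\<dots> = (if p = 0 then det B else 0)"
      using p by (simp add: adj_mat(2)[OF B])
    finally show ?thesis .
  qed
  \<comment> \<open>The scalar with \<open>v = c * e\<close>, read off from the one constraint of
    \<open>U\<close> that is not tight at \<open>e\<close>.\<close>
  define c where "c = slack i0 (\<lambda>j. of_int (v j)) / slack i0 e"
  have "slack i0 (\<lambda>j. of_int (v j)) = of_int (det B)"
    using slack_B[of 0 v] Bv[of 0] by (simp add: \<rho>'_def)
  then have c0: "c \<noteq> 0" using detB i0(2) by (simp add: c_def)
  have "(\<lambda>j. of_int (v j) - c * e j) \<in> null_space U"
    unfolding null_space_def
  proof (clarsimp simp: dot_diff_scale)
    fix u assume u: "u \<in> U"
    show "slack u (\<lambda>j. of_int (v j)) = c * slack u e"
    proof (cases "u = i0")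
      case True
      then show ?thesis using i0(2) by (simp add: c_def)
    next
      case False
      then have "slack u e = 0" using u U(1) by (auto simp: tight_def)
      moreover obtain p where "p < N" "u = \<rho> p"
        using \<rho> u False unfolding bij_betw_def by blast
      then have "slack u (\<lambda>j. of_int (v j)) = 0"
        using slack_B[of "Suc p" v] Bv[of "Suc p"] by (simp add: \<rho>'_def)
      ultimately show ?thesis by simp
    qed
  qed
  from U(3)[OF this] have ve: "of_int (v j) = c * e j" if "j < Suc N" for j
    using that unfolding nonzero_def by auto
  \<comment> \<open>For negative \<open>c\<close> the vector \<open>v\<close> points opposite to
    \<open>e\<close>; flipping the sign returns it to the cone.\<close>
  define v' where "v' j = (if 0 < c then v j else - v j)" for j
  have v'e: "of_int (v' j) = \<bar>c\<bar> * e j" if "j < Suc N" for j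
    using ve[OF that] by (simp add: v'_def)
  have val: "slack i (\<lambda>j. of_int (v' j)) = \<bar>c\<bar> * slack i e" for i
    unfolding dot_scale[symmetric] using v'e by (intro dot_cong) auto
  have "ray v'"
    unfolding ray_def
  proof (intro conjI exI[of _ \<rho>] allI impI)
    show "(\<lambda>j. real_of_int (v' j)) \<in> cone" using e_cone by (simp add: cone_def val)
    show "nonzero (\<lambda>j. real_of_int (v' j))"
      using e_nz c0 v'e unfolding nonzero_def by (metis abs_eq_0 mult_eq_0_iff)
    show "inj_on \<rho> {..<N}" using \<rho> by (simp add: bij_betw_def)
    show "\<rho> ` {..<N} \<subseteq> I" using \<rho> U(1) i0(1) by (auto simp: bij_betw_def tight_def)
    fix j assume "j < Suc N"
    moreover have "\<rho>' \<circ> insert_index 0 = \<rho>" by (auto simp: \<rho>'_def insert_index_def)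
    ultimately have "\<bar>v j\<bar> = \<bar>submatrix_det g N \<rho> (insert_index j)\<bar>"
      using abs_cofactor[of 0 N j g \<rho>' "\<lambda>q. q"] by (simp add: v_def B_def comp_def)
    then show "\<bar>v' j\<bar> = \<bar>submatrix_det g N \<rho> (insert_index j)\<bar>" by (simp add: v'_def)
  qed
  moreover have "tight z \<subseteq> tight (\<lambda>j. of_int (v' j))"
    using e(1) unfolding P_def tight_def by (auto simp: val)
  ultimately show ?thesis by (rule that)
qed

section \<open>Conic decompositions and small integer points\<close>

text \<open>Induction on the number of constraints that are not tight: a ray tight wherever
  \<open>z\<close> is can be subtracted until one more constraint becomes tight, and none is
  lost.\<close>

lemma ray_decomposition:
  assumes "z \<in> cone"
  shows "\<exists>F l. finite F \<and> (\<forall>v\<in>F. ray v \<and> 0 \<le> l v) \<and> (\<forall>j<Suc N. z j = (\<Sum>v\<in>F. l v * of_int (v j)))"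
  using assms
proof (induction "card I - card (tight z)" arbitrary: z rule: less_induct)
  case less
  show ?case
  proof (cases "nonzero z")
    case False
    then show ?thesis by (intro exI[of _ "{}"]) (auto simp: nonzero_def)
  next
    case True
    obtain v where v: "ray v" "tight z \<subseteq> tight (\<lambda>j. of_int (v j))"
      using ex_ray[OF less.prems True] .
    let ?v = "\<lambda>j. real_of_int (v j)"
    obtain t i where t: "(\<lambda>j. z j - t * ?v j) \<in> cone" "i \<in> I" "0 < slack i ?v"
      "slack i (\<lambda>j. z j - t * ?v j) = 0" "t = slack i z / slack i ?v"
      using ratio_step[of ?v z] v(1) less.prems unfolding ray_def cone_def by auto
    let ?z = "\<lambda>j. z j - t * ?v j"
    have t0: "0 \<le> t" using t(2,3,5) less.prems by (simp add: cone_def)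
    have "tight z \<subseteq> tight ?z"
      using v(2) unfolding tight_def by (auto simp: dot_diff_scale)
    moreover have "i \<in> tight ?z" "i \<notin> tight z" using t v(2) unfolding tight_def by auto
    ultimately have "tight z \<subset> tight ?z" by blast
    moreover have sub: "tight ?z \<subseteq> I" by (auto simp: tight_def)
    ultimately have "card (tight z) < card (tight ?z)" "card (tight ?z) \<le> card I"
      using finite_I by (auto intro: psubset_card_mono card_mono finite_subset)
    then have "card I - card (tight ?z) < card I - card (tight z)" by linarith
    from less.hyps[OF this t(1)] obtain F l where F: "finite F" "\<forall>v\<in>F. ray v \<and> 0 \<le> l v"
      "\<forall>j<Suc N. ?z j = (\<Sum>v\<in>F. l v * of_int (v j))" by blast
    \<comment> \<open>\<open>v\<close> may already occur in \<open>F\<close>, in which case its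
      coefficients add up.\<close>
    define l' where "l' = (\<lambda>u. (if u \<in> F then l u else 0) + (if u = v then t else 0))"
    have "z j = (\<Sum>u\<in>insert v F. l' u * of_int (u j))" if "j < Suc N" for j
    proof -
      have "(\<Sum>u\<in>insert v F. l' u * of_int (u j)) =
        (\<Sum>u\<in>insert v F. (if u \<in> F then l u else 0) * of_int (u j)) +
        (\<Sum>u\<in>insert v F. (if u = v then t * of_int (u j) else 0))"
        unfolding sum.distrib[symmetric] by (intro sum.cong) (auto simp: l'_def algebra_simps)
      also have "(\<Sum>u\<in>insert v F. (if u \<in> F then l u else 0) * of_int (u j)) =
        (\<Sum>u\<in>F. l u * of_int (u j))"
        using F(1) by (intro sum.mono_neutral_cong_right) auto
      also have "(\<Sum>u\<in>insert v F. (if u = v then t * real_of_int (u j) else 0)) = t * of_int (v j)"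
        using F(1) by (subst sum.delta) auto
      also have "(\<Sum>u\<in>F. l u * of_int (u j)) = z j - t * of_int (v j)"
        using F(3) that by simp
      finally show ?thesis by simp
    qed
    then show ?thesis
      using F(1,2) v(1) t0 by (intro exI[of _ "insert v F"] exI[of _ l']) (auto simp: l'_def)
  qed
qed

text \<open>A decomposition with the fewest rays works: more than \<open>Suc N\<close> rays are
  linearly dependent, and a multiple of the dependency removes one of them.\<close>

lemma caratheodory_decomposition:
  assumes "z \<in> cone"
  shows "\<exists>F l. finite F \<and> card F \<le> Suc N \<and> (\<forall>v\<in>F. ray v \<and> 0 \<le> l v) \<and>
    (\<forall>j<Suc N. z j = (\<Sum>v\<in>F. l v * of_int (v j)))"
proof -
  define P where "P F \<longleftrightarrow> (\<exists>l. finite F \<and> (\<forall>v\<in>F. ray v \<and> 0 \<le> l v) \<and>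
    (\<forall>j<Suc N. z j = (\<Sum>v\<in>F. l v * of_int (v j))))" for F
  obtain F0 where "P F0" using ray_decomposition[OF assms] unfolding P_def by blast
  then obtain F where F: "P F" "\<And>G. P G \<Longrightarrow> card F \<le> card G"
    using ex_has_least_nat[of P F0 card] by blast
  obtain l where l: "finite F" "\<And>v. v \<in> F \<Longrightarrow> ray v" "\<And>v. v \<in> F \<Longrightarrow> 0 \<le> l v"
    "\<And>j. j < Suc N \<Longrightarrow> z j = (\<Sum>v\<in>F. l v * of_int (v j))"
    using F(1) unfolding P_def by blast
  have "card F \<le> Suc N"
  proof (rule ccontr)
    assume "\<not> card F \<le> Suc N"
    then obtain c' where c': "\<exists>v\<in>F. c' v \<noteq> 0" "\<forall>j<Suc N. (\<Sum>v\<in>F. c' v * real_of_int (v j)) = 0"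
      using underdetermined_system[of F "Suc N" "\<lambda>v j. real_of_int (v j)"] l(1) by auto
    obtain c where c: "\<exists>v\<in>F. 0 < c v" "\<forall>j<Suc N. (\<Sum>v\<in>F. c v * real_of_int (v j)) = 0"
    proof (cases "\<exists>v\<in>F. 0 < c' v")
      case True
      then show ?thesis using that c'(2) by blast
    next
      case False
      then have "\<exists>v\<in>F. 0 < - c' v" using c'(1) by force
      moreover have "\<forall>j<Suc N. (\<Sum>v\<in>F. - c' v * real_of_int (v j)) = 0"
        using c'(2) by (simp add: sum_negf)
      ultimately show ?thesis using that[of "\<lambda>v. - c' v"] by blast
    qed
    define R where "R = {v \<in> F. 0 < c v}"
    have R: "finite R" "R \<noteq> {}" using l(1) c(1) by (auto simp: R_def)
    define q where "q v = l v / c v" for v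
    \<comment> \<open>Subtracting \<open>q u\<close> times the dependency is the largest step that
      keeps all coefficients nonnegative, and it cancels \<open>u\<close>.\<close>
    obtain u where u: "u \<in> R" "\<And>v. v \<in> R \<Longrightarrow> q u \<le> q v"
      using arg_min_if_finite(1)[OF R, of q] arg_min_least[OF R, of _ q] by blast
    define l' where "l' v = l v - q u * c v" for v
    have q0: "0 \<le> q u" using u(1) l(3) by (simp add: R_def q_def)
    have l'0: "0 \<le> l' v" if "v \<in> F" for v
    proof (cases "v \<in> R")
      case True
      then show ?thesis using u(2)[OF True] by (simp add: R_def l'_def q_def[of v] pos_le_divide_eq)
    next
      case False
      then have "q u * c v \<le> 0" using q0 that by (simp add: R_def mult_nonneg_nonpos)
      then show ?thesis using l(3)[OF that] by (simp add: l'_def)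
    qed
    have "l' u = 0" using u(1) by (simp add: l'_def q_def R_def)
    have uF: "u \<in> F" using u(1) by (simp add: R_def)
    have "z j = (\<Sum>v\<in>F - {u}. l' v * of_int (v j))" if "j < Suc N" for j
    proof -
      have "(\<Sum>v\<in>F - {u}. l' v * of_int (v j)) = (\<Sum>v\<in>F. l' v * of_int (v j))"
        using \<open>l' u = 0\<close> l(1) by (intro sum.mono_neutral_left) auto
      also have "\<dots> = (\<Sum>v\<in>F. l v * of_int (v j)) - q u * (\<Sum>v\<in>F. c v * of_int (v j))"
        by (simp add: l'_def left_diff_distrib sum_subtractf sum_distrib_left mult.assoc)
      finally show ?thesis using l(4) c(2) that by simp
    qed
    then have "P (F - {u})"
      unfolding P_def using l(1,2) l'0 by (intro exI[of _ l']) auto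
    then show False using F(2) card_Diff1_less[OF l(1) uF] by force
  qed
  then show ?thesis using l by blast
qed

text \<open>Integer multiples of the recession rays, those with last coordinate \<open>0\<close>, can be subtracted
  from an integer point until the decomposition uses them with coefficients below \<open>1\<close> only.\<close>

lemma small_integer_point:
  assumes x: "(\<lambda>j. of_int (if j < N then x j else 1)) \<in> cone"
    and bound: "\<And>v j. ray v \<Longrightarrow> j < N \<Longrightarrow> v j \<le> D"
    and last_nonneg: "\<And>v. ray v \<Longrightarrow> 0 \<le> v N"
    and D: "0 \<le> D"
  shows "\<exists>x'. (\<lambda>j. of_int (if j < N then x' j else 1)) \<in> cone \<and> (\<forall>j<N. x' j \<le> int (Suc N) * D)"
proof -
  obtain F l where F: "finite F" "card F \<le> Suc N" "\<And>v. v \<in> F \<Longrightarrow> ray v" "\<And>v. v \<in> F \<Longrightarrow> 0 \<le> l v"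
    "\<And>j. j < Suc N \<Longrightarrow> real_of_int (if j < N then x j else 1) = (\<Sum>v\<in>F. l v * of_int (v j))"
    using caratheodory_decomposition[OF x] by blast
  define F0 where "F0 = {v \<in> F. v N = 0}"
  define F1 where "F1 = {v \<in> F. v N \<noteq> 0}"
  have fin: "finite F0" "finite F1" using F(1) by (auto simp: F0_def F1_def)
  have Fun: "F = F0 \<union> F1" "F0 \<inter> F1 = {}" by (auto simp: F0_def F1_def)
  have F0F: "v \<in> F" if "v \<in> F0" for v using that by (simp add: F0_def)
  have F1F: "v \<in> F" "1 \<le> v N" if "v \<in> F1" for v
    using that last_nonneg[OF F(3), of v] by (auto simp: F1_def)
  have split: "(\<Sum>v\<in>F. h v) = (\<Sum>v\<in>F0. h v) + (\<Sum>v\<in>F1. h v)" for h :: "_ \<Rightarrow> real"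
    using fin Fun by (simp add: sum.union_disjoint)
  \<comment> \<open>Only \<open>F1\<close> contributes to the last coordinate, which is
    \<open>1\<close>. Hence \<open>F1\<close> is nonempty, leaving at most \<open>N\<close> instead
    of \<open>Suc N\<close> rays for \<open>F0\<close>.\<close>
  have one: "(\<Sum>v\<in>F1. l v * of_int (v N)) = 1"
    using F(5)[of N] by (simp add: split F0_def)
  have "F1 \<noteq> {}" using one by auto
  have "card F = card F0 + card F1"
    using fin Fun by (simp add: card_Un_disjoint)
  moreover have "card F1 \<noteq> 0" using \<open>F1 \<noteq> {}\<close> fin by simp
  ultimately have card0: "card F0 \<le> N" using F(2) by linarith
  define l' where "l' v = (if v \<in> F0 then frac (l v) else l v)" for v
  have l'0: "0 \<le> l' v" if "v \<in> F" for v using F(4)[OF that] by (simp add: l'_def)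
  \<comment> \<open>Only whole multiples of rays are removed, so \<open>x'\<close> is integral; the
    last coordinate stays \<open>1\<close> because it is \<open>0\<close> on
    \<open>F0\<close>.\<close>
  define x' where "x' j = x j - (\<Sum>v\<in>F0. \<lfloor>l v\<rfloor> * v j)" for j
  have x': "real_of_int (if j < N then x' j else 1) = (\<Sum>v\<in>F. l' v * of_int (v j))"
    if j: "j < Suc N" for j
  proof -
    have "(\<Sum>v\<in>F. l' v * of_int (v j)) =
      (\<Sum>v\<in>F0. (l v - of_int \<lfloor>l v\<rfloor>) * of_int (v j)) + (\<Sum>v\<in>F1. l v * of_int (v j))"
      unfolding split using Fun(2)
      by (intro arg_cong2[of _ _ _ _ "(+)"] sum.cong) (auto simp: l'_def frac_def)
    also have "\<dots> = (\<Sum>v\<in>F. l v * of_int (v j)) - (\<Sum>v\<in>F0. of_int \<lfloor>l v\<rfloor> * of_int (v j))"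
      by (simp add: split left_diff_distrib sum_subtractf)
    also have "\<dots> = real_of_int (if j < N then x j else 1) - (\<Sum>v\<in>F0. of_int \<lfloor>l v\<rfloor> * of_int (v j))"
      using F(5)[OF j] by simp
    also have "\<dots> = real_of_int (if j < N then x' j else 1)"
      using j by (cases "j = N") (auto simp: x'_def F0_def)
    finally show ?thesis by simp
  qed
  have "(\<lambda>j. of_int (if j < N then x' j else 1)) \<in> cone"
    unfolding cone_def
  proof (clarify)
    fix i assume i: "i \<in> I"
    have "slack i (\<lambda>j. of_int (if j < N then x' j else 1)) =
      slack i (\<lambda>j. \<Sum>v\<in>F. l' v * of_int (v j))"
      using x' by (rule dot_cong)
    also have "\<dots> = (\<Sum>v\<in>F. l' v * slack i (\<lambda>j. of_int (v j)))" by (rule dot_sum)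
    also have "\<dots> \<ge> 0"
      using F(3) l'0 i by (intro sum_nonneg mult_nonneg_nonneg) (auto simp: ray_def cone_def)
    finally show "0 \<le> slack i (\<lambda>j. of_int (if j < N then x' j else 1))" .
  qed
  moreover have "x' j \<le> int (Suc N) * D" if j: "j < N" for j
  proof -
    have "real_of_int (x' j) = (\<Sum>v\<in>F0. l' v * of_int (v j)) + (\<Sum>v\<in>F1. l' v * of_int (v j))"
      using x'[of j] j by (simp add: split)
    also have "(\<Sum>v\<in>F0. l' v * of_int (v j)) \<le> (\<Sum>v\<in>F0. of_int D)"
    proof (rule sum_mono)
      fix v assume v: "v \<in> F0"
      have "l' v * of_int (v j) \<le> l' v * of_int D"
        using bound[OF F(3)[OF F0F[OF v]] j] l'0[OF F0F[OF v]] by (intro mult_left_mono) auto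
      also have "\<dots> \<le> 1 * of_int D"
        using v D frac_lt_1[of "l v"] by (intro mult_right_mono) (auto simp: l'_def)
      finally show "l' v * of_int (v j) \<le> of_int D" by simp
    qed
    also have "(\<Sum>v\<in>F0. real_of_int D) \<le> real N * of_int D"
      using card0 D by (simp add: mult_right_mono)
    \<comment> \<open>Integrality gives \<open>v N \<ge> 1\<close>, so
      \<open>v j \<le> D \<le> v N * D\<close>. The weights \<open>l v * v N\<close> sum to
      \<open>1\<close>, so all of \<open>F1\<close> together contributes at most
      \<open>D\<close>.\<close>
    also have "(\<Sum>v\<in>F1. l' v * of_int (v j)) \<le> (\<Sum>v\<in>F1. l v * of_int (v N) * of_int D)"
    proof (rule sum_mono)
      fix v assume v: "v \<in> F1"
      have "v j \<le> v N * D"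
        using bound[OF F(3)[OF F1F(1)[OF v]] j] mult_right_mono[OF F1F(2)[OF v] D] by simp
      then have "l v * of_int (v j) \<le> l v * of_int (v N * D)"
        using F(4)[OF F1F(1)[OF v]] by (intro mult_left_mono) (auto simp only: of_int_le_iff)
      then show "l' v * of_int (v j) \<le> l v * of_int (v N) * of_int D"
        using v Fun(2) by (auto simp: l'_def mult.assoc)
    qed
    also have "(\<Sum>v\<in>F1. l v * of_int (v N) * real_of_int D) = of_int D"
      using one by (simp add: sum_distrib_right[symmetric])
    finally have "real_of_int (x' j) \<le> real_of_int (int (Suc N) * D)"
      by (simp add: distrib_right)
    then show ?thesis by linarith
  qed
  ultimately show ?thesis by blast
qed

end

subsection \<open>Small solutions of nonnegative systems\<close>

text \<open>\<open>Inl\<close> indexes the inequalities, with right-hand sides moved to column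
  \<open>N\<close>; \<open>Inr\<close> indexes nonnegativity of the coordinates. The disjoint sum
  keeps rows with equal entries apart.\<close>

definition homogeneous_row ::
  "nat \<Rightarrow> (nat \<Rightarrow> nat \<Rightarrow> int) \<Rightarrow> (nat \<Rightarrow> int) \<Rightarrow> nat + nat \<Rightarrow> nat \<Rightarrow> int" where
  "homogeneous_row N c \<beta> = case_sum (\<lambda>i j. if j < N then c i j else - \<beta> i) (\<lambda>p j. of_bool (j = p))"

lemma dot_homogeneous_row_Inl:
  "dot (Suc N) (homogeneous_row N c \<beta> (Inl i)) z = (\<Sum>j<N. of_int (c i j) * z j) - of_int (\<beta> i) * z N"
  by (simp add: dot_def homogeneous_row_def)

lemma dot_homogeneous_row_Inr:
  assumes "p \<le> N"
  shows "dot (Suc N) (homogeneous_row N c \<beta> (Inr p)) z = z p"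
proof -
  have "dot (Suc N) (homogeneous_row N c \<beta> (Inr p)) z = (\<Sum>j<Suc N. if j = p then z j else 0)"
    unfolding dot_def homogeneous_row_def by (intro sum.cong) auto
  also have "\<dots> = z p" using assms by (subst sum.delta) auto
  finally show ?thesis .
qed

text \<open>\<open>S\<close> contains every row that is not a network row. The lower bounds and the
  nonemptiness of \<open>M\<close> make each factor of the final bound at least
  \<open>1\<close>.\<close>

locale nonneg_system =
  fixes N w :: nat and M S :: "nat set" and c :: "nat \<Rightarrow> nat \<Rightarrow> int" and \<beta> :: "nat \<Rightarrow> int"
    and A B :: int
  assumes finite_M: "finite M" and M_nonempty: "M \<noteq> {}" and N_pos: "0 < N" and S_sub: "S \<subseteq> M"
    and network: "\<And>i. i \<in> M - S \<Longrightarrow> network_row {..<N} (c i)"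
    and coeff_le: "\<And>i j. i \<in> S \<Longrightarrow> j < N \<Longrightarrow> \<bar>c i j\<bar> \<le> A"
    and width_le: "\<And>i. i \<in> S \<Longrightarrow> card {j \<in> {..<N}. c i j \<noteq> 0} \<le> w"
    and Aw: "0 \<le> A" "1 \<le> A * int w"
    and rhs_le: "\<And>i. i \<in> M \<Longrightarrow> \<bar>\<beta> i\<bar> \<le> B" and B_pos: "1 \<le> B"
begin

abbreviation "system_row \<equiv> homogeneous_row N c \<beta>"

text \<open>Pointed because the nonnegativity rows comprise all unit vectors.\<close>

sublocale pointed_cone "M <+> {..N}" system_row N
proof
  show "finite (M <+> {..N})" using finite_M by simp
  fix y assume y: "\<And>i. i \<in> M <+> {..N} \<Longrightarrow> dot (Suc N) (system_row i) y = 0"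
  show "\<forall>j<Suc N. y j = 0"
  proof (intro allI impI)
    fix j assume "j < Suc N"
    then have "Inr j \<in> M <+> {..N}" "j \<le> N" by auto
    then show "y j = 0" using y[of "Inr j"] by (simp add: dot_homogeneous_row_Inr)
  qed
qed

lemma mem_cone_iff:
  "(\<lambda>j. of_int (if j < N then x j else 1)) \<in> cone \<longleftrightarrow>
    (\<forall>j<N. 0 \<le> x j) \<and> (\<forall>i\<in>M. \<beta> i \<le> (\<Sum>j<N. c i j * x j))"
proof -
  let ?z = "\<lambda>j. real_of_int (if j < N then x j else 1)"
  have "slack (Inl i) ?z = of_int ((\<Sum>j<N. c i j * x j) - \<beta> i)" for i
    by (simp add: dot_homogeneous_row_Inl)
  then have 1: "0 \<le> slack (Inl i) ?z \<longleftrightarrow> \<beta> i \<le> (\<Sum>j<N. c i j * x j)" for i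
    by (simp only: of_int_0_le_iff) simp
  have 2: "0 \<le> slack (Inr p) ?z \<longleftrightarrow> 0 \<le> (if p < N then x p else 1)" if "p \<le> N" for p
    by (simp only: dot_homogeneous_row_Inr[OF that] of_int_0_le_iff)
  have "?z \<in> cone \<longleftrightarrow> (\<forall>i\<in>M. 0 \<le> slack (Inl i) ?z) \<and> (\<forall>p\<in>{..N}. 0 \<le> slack (Inr p) ?z)"
    unfolding cone_def by (auto simp del: of_int_0_le_iff)
  also have "\<dots> \<longleftrightarrow> (\<forall>i\<in>M. \<beta> i \<le> (\<Sum>j<N. c i j * x j)) \<and> (\<forall>p\<in>{..N}. 0 \<le> (if p < N then x p else 1))"
    unfolding 1 by (intro conj_cong refl ball_cong) (simp add: 2 del: of_int_0_le_iff)
  also have "\<dots> \<longleftrightarrow> (\<forall>j<N. 0 \<le> x j) \<and> (\<forall>i\<in>M. \<beta> i \<le> (\<Sum>j<N. c i j * x j))"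
    by auto
  finally show ?thesis .
qed

definition minor_bound :: int where
  "minor_bound = (A * int w) ^ card S"

text \<open>At most \<open>min N (card M)\<close> selected inequalities carry a right-hand side, of
  size at most \<open>B\<close>; each multiplies a minor free of that column.\<close>

definition det_bound :: int where
  "det_bound = int (min N (card M)) * B * minor_bound"

lemma minor_bound_pos: "1 \<le> minor_bound"
  unfolding minor_bound_def using Aw(2) by (rule one_le_power)

lemma minor_bound_le_det_bound: "minor_bound \<le> det_bound"
proof -
  have "0 < card M" using finite_M M_nonempty by (simp add: card_gt_0_iff)
  then have "1 * 1 \<le> int (min N (card M)) * B"
    using B_pos N_pos by (intro mult_mono) auto
  then show ?thesis
    using mult_right_mono[of 1 "int (min N (card M)) * B" minor_bound] minor_bound_pos
    by (simp add: det_bound_def)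
qed

text \<open>Away from column \<open>N\<close> the nonnegativity rows are zero or unit vectors, hence
  network rows, so only \<open>S\<close> contributes factors.\<close>

lemma abs_minor_le:
  assumes "inj_on \<rho> {..<r}" "\<rho> ` {..<r} \<subseteq> M <+> {..N}" "inj_on \<kappa> {..<r}" "\<kappa> ` {..<r} \<subseteq> {..<N}"
  shows "\<bar>submatrix_det system_row r \<rho> \<kappa>\<bar> \<le> minor_bound"
proof -
  have "\<bar>submatrix_det system_row r \<rho> \<kappa>\<bar> \<le> (A * int w) ^ card (Inl ` S :: (nat + nat) set)"
  proof (rule abs_submatrix_det_le_power[OF _ _ _ _ _ Aw(2,1) assms])
    fix i :: "nat + nat" assume i: "i \<in> M <+> {..N} - Inl ` S"
    show "network_row {..<N} (system_row i)"
    proof (cases i)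
      case (Inl l)
      then have "network_row {..<N} (c l)" using i by (intro network) auto
      then show ?thesis unfolding Inl network_row_def homogeneous_row_def by simp
    qed (auto simp: network_row_def homogeneous_row_def)
  next
    fix i :: "nat + nat" assume i: "i \<in> Inl ` S"
    then show "\<bar>system_row i j\<bar> \<le> A" if "j \<in> {..<N}" for j
      using that coeff_le by (auto simp: homogeneous_row_def)
    obtain l where l: "i = Inl l" "l \<in> S" using i by auto
    have "{j \<in> {..<N}. system_row i j \<noteq> 0} = {j \<in> {..<N}. c l j \<noteq> 0}"
      by (auto simp: homogeneous_row_def l)
    then show "card {j \<in> {..<N}. system_row i j \<noteq> 0} \<le> w" using width_le[OF l(2)] by simp
  qed (use finite_M S_sub in \<open>auto intro: finite_subset\<close>)
  then show ?thesis by (simp add: minor_bound_def card_image)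
qed

text \<open>Expand along the row of the homogenising coordinate if it occurs, and along the column of
  the right-hand sides otherwise.\<close>

lemma ray_entry_le:
  assumes "ray v" "j < N"
  shows "v j \<le> det_bound"
proof -
  obtain \<rho> where \<rho>: "inj_on \<rho> {..<N}" "\<rho> ` {..<N} \<subseteq> M <+> {..N}"
    and vj: "\<bar>v j\<bar> = \<bar>submatrix_det system_row N \<rho> (insert_index j)\<bar>"
    using assms unfolding ray_def by auto
  obtain r where r: "N = Suc r" using N_pos gr0_conv_Suc by blast
  \<comment> \<open>Skipping a column \<open>j < N\<close> keeps the column of right-hand sides, in
    last position \<open>r\<close>.\<close>
  have last: "insert_index j r = N" using assms(2) r by simp
  have other: "insert_index j q < N" if "q < r" for q using that r by (simp add: insert_index_def)
  have minor: "\<bar>submatrix_det system_row r (\<rho> \<circ> insert_index i) (insert_index j \<circ> insert_index r)\<bar> \<le> minor_bound"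
    if "i < N" for i
  proof (rule abs_minor_le)
    show "inj_on (\<rho> \<circ> insert_index i) {..<r}" "(\<rho> \<circ> insert_index i) ` {..<r} \<subseteq> M <+> {..N}"
      using inj_on_comp_insert_index[OF \<rho>[unfolded r], of i] that r by blast+
    show "inj_on (insert_index j \<circ> insert_index r) {..<r}"
      by (intro comp_inj_on insert_index_inj_on)
    show "(insert_index j \<circ> insert_index r) ` {..<r} \<subseteq> {..<N}" using other by auto
  qed
  have "\<bar>submatrix_det system_row N \<rho> (insert_index j)\<bar> \<le> det_bound"
  proof (cases "\<exists>i<N. \<rho> i = Inr N")
    case True
    then obtain i where i: "i < N" "\<rho> i = Inr N" by blast
    have "\<bar>submatrix_det system_row N \<rho> (insert_index j)\<bar> \<le> (\<Sum>q<Suc r. \<bar>system_row (\<rho> i) (insert_index j q)\<bar> *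
      \<bar>submatrix_det system_row r (\<rho> \<circ> insert_index i) (insert_index j \<circ> insert_index q)\<bar>)"
      unfolding r using i(1) by (intro abs_submatrix_det_le_row) (simp add: r)
    also have "\<dots> = \<bar>submatrix_det system_row r (\<rho> \<circ> insert_index i) (insert_index j \<circ> insert_index r)\<bar>"
    proof -
      have "system_row (\<rho> i) (insert_index j q) = 0" if "q < r" for q
        using other[OF that] by (simp add: i(2) homogeneous_row_def)
      moreover have "system_row (\<rho> i) (insert_index j r) = 1"
        unfolding last by (simp add: i(2) homogeneous_row_def)
      ultimately show ?thesis by simp
    qed
    finally show ?thesis using minor[OF i(1)] minor_bound_le_det_bound by linarith
  next
    case False
    \<comment> \<open>The selected inequalities; as \<open>\<rho>\<close> is injective there are at
      most \<open>card M\<close>, whence the minimum in the bound.\<close>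
    let ?L = "{i \<in> {..<N}. \<rho> i \<in> Inl ` M}"
    have le: "\<bar>system_row (\<rho> i) N\<bar> \<le> B" if "i \<in> ?L" for i
      using that rhs_le by (auto simp: homogeneous_row_def)
    have zero: "system_row (\<rho> i) N = 0" if "i \<in> {..<N} - ?L" for i
    proof -
      have "\<rho> i \<in> M <+> {..N}" "\<rho> i \<noteq> Inr N" "\<rho> i \<notin> Inl ` M" using that \<rho>(2) False by auto
      then show ?thesis by (auto simp: homogeneous_row_def)
    qed
    have "card ?L = card (\<rho> ` ?L)" using \<rho>(1) by (intro card_image[symmetric] inj_on_subset[OF \<rho>(1)]) auto
    also have "\<dots> \<le> card (Inl ` M :: (nat + nat) set)" using finite_M by (intro card_mono) auto
    finally have "card ?L \<le> card M" by (simp add: card_image)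
    moreover have "card ?L \<le> card {..<N}" by (intro card_mono) auto
    ultimately have cardL: "card ?L \<le> min N (card M)" by simp
    have "\<bar>submatrix_det system_row N \<rho> (insert_index j)\<bar> \<le> (\<Sum>i<N. \<bar>system_row (\<rho> i) N\<bar> *
      \<bar>submatrix_det system_row r (\<rho> \<circ> insert_index i) (insert_index j \<circ> insert_index r)\<bar>)"
      using abs_submatrix_det_le_column[of r r system_row \<rho> "insert_index j"] unfolding last r by simp
    also have "\<dots> = (\<Sum>i\<in>?L. \<bar>system_row (\<rho> i) N\<bar> *
      \<bar>submatrix_det system_row r (\<rho> \<circ> insert_index i) (insert_index j \<circ> insert_index r)\<bar>)"
      using zero by (intro sum.mono_neutral_right) auto
    also have "\<dots> \<le> (\<Sum>i\<in>?L. B * minor_bound)"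
      using le minor B_pos by (intro sum_mono mult_mono) auto
    also have "\<dots> = int (card ?L) * (B * minor_bound)" by simp
    also have "\<dots> \<le> int (min N (card M)) * (B * minor_bound)"
      using cardL B_pos minor_bound_pos by (intro mult_right_mono) auto
    finally show ?thesis by (simp add: det_bound_def mult.assoc)
  qed
  then show ?thesis using vj by linarith
qed

lemma small_solution:
  assumes "\<forall>j<N. 0 \<le> x j" "\<forall>i\<in>M. \<beta> i \<le> (\<Sum>j<N. c i j * x j)"
  shows "\<exists>x. (\<forall>j<N. 0 \<le> x j) \<and> (\<forall>i\<in>M. \<beta> i \<le> (\<Sum>j<N. c i j * x j)) \<and>
    (\<forall>j<N. x j \<le> int (Suc N) * det_bound)"
proof -
  have "0 \<le> v N" if "ray v" for v
  proof -
    have "0 \<le> slack (Inr N) (\<lambda>j. of_int (v j))"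
      using that unfolding ray_def cone_def by auto
    then show ?thesis by (simp add: dot_homogeneous_row_Inr)
  qed
  moreover have "0 \<le> det_bound"
    using minor_bound_pos minor_bound_le_det_bound by linarith
  ultimately show ?thesis
    using small_integer_point[of x det_bound] assms ray_entry_le unfolding mem_cone_iff by blast
qed

end

section \<open>From the formula to an oriented system\<close>

lemma network_row_uminus:
  assumes "network_row J r"
  shows "network_row J (\<lambda>j. - r j)"
  using assms unfolding network_row_def by force

lemma difference_constraint_network_row:
  assumes "difference_constraint n \<psi>"
  shows "network_row {..<Suc n} (coeff \<psi>)"
proof -
  have eq: "{..<Suc n} = {0..n}" by auto
  have vals: "coeff \<psi> j = -1 \<or> coeff \<psi> j = 0 \<or> coeff \<psi> j = 1" if "j \<in> {0..n}" for j
    using assms that unfolding difference_constraint_def by blast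
  have "i = j" if "i \<in> {0..n}" "j \<in> {0..n}" "coeff \<psi> i = coeff \<psi> j" "coeff \<psi> i \<noteq> 0" for i j
    using assms vals[OF that(1)] that unfolding difference_constraint_def by metis
  with vals show ?thesis unfolding network_row_def eq by blast
qed

text \<open>Reduces the search for a small solution of the formula to keeping the truth value of
  every atom.\<close>

lemma sat_cong:
  assumes "\<And>\<psi>. \<psi> \<in> atoms F \<Longrightarrow> sat_constraint V x \<psi> \<longleftrightarrow> sat_constraint V y \<psi>"
  shows "sat V x F \<longleftrightarrow> sat V y F"
  using assms by (induction F) auto

lemma atoms_nonempty: "atoms F \<noteq> {}"
  by (induction F) auto

theorem theorem7:
  fixes n m k w s :: nat
    and a :: "nat \<Rightarrow> nat \<Rightarrow> int" and b :: "nat \<Rightarrow> int"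
    and \<phi> \<phi>' :: "nat \<Rightarrow> lin_constraint"
    and \<Phi> \<Phi>' :: presburger
    and a_max b_max \<Delta> :: int
  assumes "\<And>i. \<phi> i = Geq (a i) (b i)"
    and "atoms \<Phi> \<subseteq> \<phi> ` {1..m}"
    and "\<And>i. \<phi>' i = zero_var_constraint n (\<phi> i)"
    and "\<Phi>' = zero_var n \<Phi>"
    and "card {i \<in> {1..m}. difference_constraint n (\<phi>' i)} + k = m"
    and "k \<le> n + 1"
    and "w \<ge> 1"
    and "\<And>i. i \<in> {1..m} \<Longrightarrow> \<not> difference_constraint n (\<phi>' i) \<Longrightarrow>
           card {j \<in> {0..n}. coeff (\<phi>' i) j \<noteq> 0} \<le> w"
    and "a_max = Max {\<bar>coeff (\<phi>' i) j\<bar> | i j. i \<in> {1..m} \<and> j \<in> {0..n}}"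
    and "b_max = Max {\<bar>b i\<bar> | i. i \<in> {1..m}}"
    and "s = min (n + 1) m"
    and "\<Delta> = int s * (b_max + 1) * (a_max * int w) ^ k"
    and "\<exists>x. (\<forall>j\<in>{0..n}. x j \<ge> 0) \<and> sat {0..n} x \<Phi>'"
  shows "\<exists>x. (\<forall>j\<in>{0..n}. x j \<ge> 0) \<and> sat {0..n} x \<Phi>' \<and>
             (\<forall>j\<in>{0..n}. x j \<le> int (n + 2) * \<Delta>)"
proof -
  obtain x where x: "\<forall>j\<in>{0..n}. 0 \<le> x j" "sat {0..n} x \<Phi>'" using assms(13) by blast
  have atoms': "atoms \<Phi>' \<subseteq> \<phi>' ` {1..m}"
    using assms(2,3) unfolding assms(4) zero_var_def by (auto simp: formula.set_map)
  then have "1 \<le> m" using atoms_nonempty[of \<Phi>'] by auto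
  have idx: "{0..n} = {..<Suc n}" by auto
  have bound': "bound (\<phi>' i) = b i" for i
    by (simp add: assms(1,3) zero_var_constraint_def)
  have "finite {\<bar>coeff (\<phi>' i) j\<bar> | i j. i \<in> {1..m} \<and> j \<in> {0..n}}"
    by (rule finite_image_set2) auto
  then have a_le: "\<bar>coeff (\<phi>' i) j\<bar> \<le> a_max" if "i \<in> {1..m}" "j \<in> {0..n}" for i j
    unfolding assms(9) using that by (intro Max_ge) auto
  have "finite {\<bar>b i\<bar> | i. i \<in> {1..m}}" by (rule finite_image_set) auto
  then have b_le: "\<bar>b i\<bar> \<le> b_max" if "i \<in> {1..m}" for i
    unfolding assms(10) using that by (intro Max_ge) auto
  have a0: "0 \<le> a_max" using a_le[of 1 0] \<open>1 \<le> m\<close> by simp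
  have b0: "0 \<le> b_max" using b_le[of 1] \<open>1 \<le> m\<close> by simp
  have \<Delta>0: "0 \<le> \<Delta>" using a0 b0 by (simp add: assms(12))
  show ?thesis
  proof (cases "a_max = 0")
    \<comment> \<open>With all coefficients zero, the origin satisfies the same constraints as
      \<open>x\<close>. The case is separate because the expansion factor
      \<open>a_max * int w\<close> has to be at least \<open>1\<close>.\<close>
    case True
    then have "coeff (\<phi>' i) j = 0" if "i \<in> {1..m}" "j \<in> {0..n}" for i j
      using a_le[OF that] by simp
    then have "sat_constraint {0..n} (\<lambda>_. 0) \<psi> \<longleftrightarrow> sat_constraint {0..n} x \<psi>" if "\<psi> \<in> atoms \<Phi>'" for \<psi>
      using that atoms' by (auto simp: sat_constraint_def)
    then have "sat {0..n} (\<lambda>_. 0) \<Phi>'" using x(2) sat_cong by blast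
    then show ?thesis using \<Delta>0 by (intro exI[of _ "\<lambda>_. 0"]) auto
  next
    case False
    define S where "S = {i \<in> {1..m}. \<not> difference_constraint n (\<phi>' i)}"
    have "S = {1..m} - {i \<in> {1..m}. difference_constraint n (\<phi>' i)}" by (auto simp: S_def)
    then have "card S = card {1..m} - card {i \<in> {1..m}. difference_constraint n (\<phi>' i)}"
      by (simp only:) (rule card_Diff_subset, auto)
    then have cardS: "card S = k" using assms(5) by simp
    define pos where "pos i \<longleftrightarrow> sat_constraint {0..n} x (\<phi>' i)" for i
    define c where "c i j = (if pos i then coeff (\<phi>' i) j else - coeff (\<phi>' i) j)" for i j
    \<comment> \<open>Over the integers, failure of \<open>t \<ge> b\<close> means
      \<open>- t \<ge> 1 - b\<close>; hence the bound \<open>b_max + 1\<close>.\<close>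
    define \<beta> where "\<beta> i = (if pos i then b i else 1 - b i)" for i
    \<comment> \<open>Solutions of the oriented system are the points at which each constraint has
      the truth value it has at \<open>x\<close>.\<close>
    have lit: "\<beta> i \<le> (\<Sum>j<Suc n. c i j * y j) \<longleftrightarrow> (sat_constraint {0..n} y (\<phi>' i) \<longleftrightarrow> pos i)" for i y
      unfolding sat_constraint_def c_def \<beta>_def idx bound'
      by (cases "pos i") (auto simp: sum_negf simp del: sum.lessThan_Suc)
    interpret nonneg_system "Suc n" w "{1..m}" S c \<beta> a_max "b_max + 1"
    proof
      show "network_row {..<Suc n} (c i)" if "i \<in> {1..m} - S" for i
      proof -
        have "network_row {..<Suc n} (coeff (\<phi>' i))"
          using that by (intro difference_constraint_network_row) (auto simp: S_def)
        then show ?thesis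
          using network_row_uminus[of _ "coeff (\<phi>' i)"] by (cases "pos i") (auto simp: c_def[abs_def])
      qed
      show "\<bar>c i j\<bar> \<le> a_max" if "i \<in> S" "j < Suc n" for i j
        using a_le[of i j] that by (auto simp: S_def c_def)
      show "card {j \<in> {..<Suc n}. c i j \<noteq> 0} \<le> w" if "i \<in> S" for i
      proof -
        have "{j \<in> {..<Suc n}. c i j \<noteq> 0} = {j \<in> {0..n}. coeff (\<phi>' i) j \<noteq> 0}"
          by (auto simp: c_def)
        then show ?thesis using assms(8)[of i] that by (simp add: S_def)
      qed
      show "1 \<le> a_max * int w"
        using mult_mono[of 1 a_max 1 "int w"] a0 False assms(7) by simp
      show "\<bar>\<beta> i\<bar> \<le> b_max + 1" if "i \<in> {1..m}" for i
        using b_le[OF that] by (auto simp: \<beta>_def)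
    qed (use \<open>1 \<le> m\<close> a0 b0 in \<open>auto simp: S_def\<close>)
    have "\<forall>j<Suc n. 0 \<le> x j" "\<forall>i\<in>{1..m}. \<beta> i \<le> (\<Sum>j<Suc n. c i j * x j)"
      using x(1) unfolding lit by (auto simp: pos_def)
    from small_solution[OF this] obtain y where y: "\<forall>j<Suc n. 0 \<le> y j"
      "\<forall>i\<in>{1..m}. sat_constraint {0..n} y (\<phi>' i) \<longleftrightarrow> pos i"
      "\<forall>j<Suc n. y j \<le> int (Suc (Suc n)) * det_bound"
      unfolding lit by blast
    have "sat {0..n} y \<Phi>' \<longleftrightarrow> sat {0..n} x \<Phi>'"
      using y(2) atoms' by (intro sat_cong) (auto simp: pos_def)
    \<comment> \<open>Here \<open>N\<close> is \<open>n + 1\<close>, so the minimum is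
      \<open>s\<close> and the factor \<open>Suc N\<close> is \<open>n + 2\<close>.\<close>
    moreover have "det_bound = \<Delta>"
      unfolding det_bound_def minor_bound_def cardS assms(11,12) by simp
    ultimately show ?thesis using x(2) y(1,3) unfolding idx by (intro exI[of _ y]) auto
  qed
qed

end
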